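(* For $g=0.0215$, the Threshold Algorithm is $246C$-competitive for the Reading Articles Online problem (with the standing assumptions below), i.e. for every such instance $I$ with hint accuracy $C$, $\mathrm{Opt}(I)\le 246C\cdot\mathbb{E}[\text{Threshold Algorithm}(I)]$ (and $246C<90.5\,\mathrm{e}\,C$).
   Context: Notation: $[m]=\{1,\dots,m\}$. Reading Articles Online (RAO): there are $n$ articles revealed one by one; time budget $T\in\mathbb{N}_{>0}$. Article $i$ has a hint $h_i\in\mathbb{N}_{>0}$, a length $t_i\in\mathbb{N}_{>0}$ and an unknown information rate $c_i:[t_i]\to[h_i]$. When article $i$ arrives the reader sees $h_i,t_i$ and decides to start reading or to skip; while reading, the reader obtains $c_i(j)$ information units for time step $j$ and may at any point discard the article irrevocably; then the next article arrives. Reading may stop at fractional times: reading $\tau_i\in[0,t_i]$ time units yields $\sum_{j=1}^{\lfloor\tau_i\rfloor}c_i(j)+c_i(\lceil\tau_i\rceil)\{\tau_i\}$, where $\{\tau_i\}$ is the fractional part. Objective: maximize the total information obtained subject to $\sum_i\tau_i\le T$. The arrival order is a uniformly random permutation $\pi$ (article $i$ arrives in round $\pi(i)$). An algorithm is $\beta$-competitive if $\mathbb{E}[\mathrm{Alg}(I)]\ge\mathrm{Opt}(I)/\beta$ for every instance $I$, expectation over $\pi$ and internal randomness, $\mathrm{Opt}(I)$ the optimal offline value. Accuracy: $C\ge1$ is the smallest number with $h_i\le C\sum_{j=1}^{t_i}c_i(j)/t_i$ for all $i$. Standing assumptions: each $c_i$ is non-increasing; $t_i\le T$ for all $i$; the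 hints $h_i$ are pairwise distinct and the values $t_ih_i$ are pairwise distinct; and $\sum_{i\in[n]}\min\{t_i,gT\}\ge 3T/2$. Threshold Algorithm (parameter $g\in(0,1]$): sample $r$ from the binomial distribution $\mathrm{Bin}(n,1/2)$; the articles arriving in rounds $1,\dots,r$ form the set $X$ and are observed but not read. Solve the fractional knapsack problem on the articles of $X$ with capacity $T/2$, weights $t'_i=\min\{gT,t_i\}$ and values $t'_ih_i$; in its optimal solution there is a threshold hint $\rho$ such that articles of $X$ with $h_i>\rho$ are fully included and those with $h_i<\rho$ are excluded. For each article $i$ arriving in rounds $r+1,\dots,n$: if $h_i\ge\rho$, read the first $s_i=\min\{t_i,gT,T-\sum_{\text{earlier }j}s_j\}$ time units of article $i$; otherwise set $s_i=0$ and skip it. *)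

theory Defs
  imports "HOL-Probability.Probability"
begin

section \<open>Instances of Reading Articles Online\<close>

record rao =
  num_articles :: nat
  budget :: nat
  hint :: "nat \<Rightarrow> nat"
  len :: "nat \<Rightarrow> nat"
  rate :: "nat \<Rightarrow> nat \<Rightarrow> nat"

definition articles :: "rao \<Rightarrow> nat set" where
  "articles I = {1..num_articles I}"

definition rao_instance :: "rao \<Rightarrow> bool" where
  "rao_instance I \<longleftrightarrow> 0 < budget I \<and>
     (\<forall>i\<in>articles I. 0 < hint I i \<and> 0 < len I i \<and> rate I i ` {1..len I i} \<subseteq> {1..hint I i})"

definition standing_assumptions :: "real \<Rightarrow> rao \<Rightarrow> bool" where
  "standing_assumptions g I \<longleftrightarrow>
     (\<forall>i\<in>articles I. antimono_on {1..len I i} (rate I i)) \<and>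
     (\<forall>i\<in>articles I. len I i \<le> budget I) \<and>
     inj_on (hint I) (articles I) \<and>
     inj_on (\<lambda>i. len I i * hint I i) (articles I) \<and>
     (\<Sum>i\<in>articles I. min (real (len I i)) (g * real (budget I))) \<ge> 3 * real (budget I) / 2"

text \<open>Information units obtained by reading the first \<open>\<tau>\<close> time units of article \<open>i\<close>.
  If \<open>\<tau>\<close> is an integer, the second summand vanishes.\<close>

definition info :: "rao \<Rightarrow> nat \<Rightarrow> real \<Rightarrow> real" where
  "info I i \<tau> = (\<Sum>j=1..nat \<lfloor>\<tau>\<rfloor>. real (rate I i j)) + real (rate I i (nat \<lceil>\<tau>\<rceil>)) * frac \<tau>"

definition feasible_times :: "rao \<Rightarrow> (nat \<Rightarrow> real) set" where
  "feasible_times I = {\<tau>. (\<forall>i\<in>articles I. 0 \<le> \<tau> i \<and> \<tau> i \<le> real (len I i)) \<and>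
     (\<Sum>i\<in>articles I. \<tau> i) \<le> real (budget I)}"

definition opt :: "rao \<Rightarrow> real" where
  "opt I = (SUP \<tau>\<in>feasible_times I. \<Sum>i\<in>articles I. info I i (\<tau> i))"

definition accuracy_bound :: "rao \<Rightarrow> real \<Rightarrow> bool" where
  "accuracy_bound I C \<longleftrightarrow> 1 \<le> C \<and>
     (\<forall>i\<in>articles I. real (hint I i) \<le> C * ((\<Sum>j=1..len I i. real (rate I i j)) / real (len I i)))"

definition accuracy :: "rao \<Rightarrow> real" where
  "accuracy I = (LEAST C. accuracy_bound I C)"


section \<open>Fractional knapsack and threshold hints\<close>

text \<open>Solutions \<open>x\<close> give the fraction of each item that is packed.\<close>

definition knapsack_feasible ::
    "nat set \<Rightarrow> (nat \<Rightarrow> real) \<Rightarrow> real \<Rightarrow> (nat \<Rightarrow> real) \<Rightarrow> bool" where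
  "knapsack_feasible X w cap x \<longleftrightarrow>
     (\<forall>i\<in>X. 0 \<le> x i \<and> x i \<le> 1) \<and> (\<Sum>i\<in>X. w i * x i) \<le> cap"

definition knapsack_optimal ::
    "nat set \<Rightarrow> (nat \<Rightarrow> real) \<Rightarrow> (nat \<Rightarrow> real) \<Rightarrow> real \<Rightarrow> (nat \<Rightarrow> real) \<Rightarrow> bool" where
  "knapsack_optimal X w v cap x \<longleftrightarrow> knapsack_feasible X w cap x \<and>
     (\<forall>y. knapsack_feasible X w cap y \<longrightarrow> (\<Sum>i\<in>X. v i * y i) \<le> (\<Sum>i\<in>X. v i * x i))"

definition short_len :: "real \<Rightarrow> rao \<Rightarrow> nat \<Rightarrow> real" where
  "short_len g I i = min (g * real (budget I)) (real (len I i))"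

definition is_threshold :: "real \<Rightarrow> rao \<Rightarrow> nat set \<Rightarrow> real \<Rightarrow> bool" where
  "is_threshold g I X \<rho> \<longleftrightarrow>
     (\<exists>x. knapsack_optimal X (short_len g I) (\<lambda>i. short_len g I i * real (hint I i))
             (real (budget I) / 2) x \<and>
          (\<forall>i\<in>X. (real (hint I i) > \<rho> \<longrightarrow> x i = 1) \<and> (real (hint I i) < \<rho> \<longrightarrow> x i = 0)))"

text \<open>A threshold need not be unique, for instance if \<open>X\<close> fits into the knapsack or is empty.
  A threshold rule fixes an arbitrary admissible choice for every possible sample.\<close>

definition threshold_rule :: "real \<Rightarrow> rao \<Rightarrow> (nat set \<Rightarrow> real) \<Rightarrow> bool" where
  "threshold_rule g I \<rho> \<longleftrightarrow> (\<forall>X\<subseteq>articles I. is_threshold g I X (\<rho> X))"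


section \<open>The Threshold Algorithm\<close>

text \<open>Article \<open>i\<close> arrives in round \<open>\<pi> i\<close>, so the article of round \<open>k\<close> is \<open>inv \<pi> k\<close>.
  The following is the time spent in round \<open>k\<close> when the first \<open>r\<close> rounds are only observed
  and \<open>\<theta>\<close> is the threshold.\<close>

function round_time :: "real \<Rightarrow> rao \<Rightarrow> real \<Rightarrow> (nat \<Rightarrow> nat) \<Rightarrow> nat \<Rightarrow> nat \<Rightarrow> real" where
  "round_time g I \<theta> \<pi> r k =
     (if r < k \<and> real (hint I (inv \<pi> k)) \<ge> \<theta>
      then Min {real (len I (inv \<pi> k)), g * real (budget I),
                real (budget I) - (\<Sum>l\<in>{r<..<k}. round_time g I \<theta> \<pi> r l)}
      else 0)"
  by pat_completeness auto
termination
  by (relation "Wellfounded.measure (\<lambda>(g, I, \<theta>, \<pi>, r, k). k)") auto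

declare round_time.simps [simp del]

definition sample :: "rao \<Rightarrow> (nat \<Rightarrow> nat) \<Rightarrow> nat \<Rightarrow> nat set" where
  "sample I \<pi> r = {i\<in>articles I. \<pi> i \<le> r}"

definition read_time ::
    "real \<Rightarrow> rao \<Rightarrow> (nat set \<Rightarrow> real) \<Rightarrow> (nat \<Rightarrow> nat) \<Rightarrow> nat \<Rightarrow> nat \<Rightarrow> real" where
  "read_time g I \<rho> \<pi> r i = round_time g I (\<rho> (sample I \<pi> r)) \<pi> r (\<pi> i)"

definition threshold_gain ::
    "real \<Rightarrow> rao \<Rightarrow> (nat set \<Rightarrow> real) \<Rightarrow> (nat \<Rightarrow> nat) \<Rightarrow> nat \<Rightarrow> real" where
  "threshold_gain g I \<rho> \<pi> r = (\<Sum>i\<in>articles I. info I i (read_time g I \<rho> \<pi> r i))"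

definition expected_threshold_gain :: "real \<Rightarrow> rao \<Rightarrow> (nat set \<Rightarrow> real) \<Rightarrow> real" where
  "expected_threshold_gain g I \<rho> =
     measure_pmf.expectation
       (pair_pmf (pmf_of_set {\<pi>. \<pi> permutes articles I}) (binomial_pmf (num_articles I) (1/2)))
       (\<lambda>(\<pi>, r). threshold_gain g I \<rho> \<pi> r)"


section \<open>Well-definedness\<close>

text \<open>The supremum, the least bound and the thresholds used above exist.\<close>

lemma finite_articles [simp]: "finite (articles I)"
  by (simp add: articles_def)

lemma info_le:
  assumes "0 \<le> \<tau>" "\<tau> \<le> real (len I i)"
  shows "info I i \<tau> \<le> 2 * (\<Sum>j\<le>len I i. real (rate I i j))"
proof -
  have a: "nat \<lfloor>\<tau>\<rfloor> \<le> len I i" "nat \<lceil>\<tau>\<rceil> \<le> len I i"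
    using assms by linarith+
  have "(\<Sum>j=1..nat \<lfloor>\<tau>\<rfloor>. real (rate I i j)) \<le> (\<Sum>j\<le>len I i. real (rate I i j))"
    using a by (intro sum_mono2) auto
  moreover have "real (rate I i (nat \<lceil>\<tau>\<rceil>)) * frac \<tau> \<le> real (rate I i (nat \<lceil>\<tau>\<rceil>)) * 1"
    using frac_lt_1[of \<tau>] by (intro mult_left_mono) auto
  moreover have "real (rate I i (nat \<lceil>\<tau>\<rceil>)) \<le> (\<Sum>j\<le>len I i. real (rate I i j))"
    using a by (intro member_le_sum) auto
  ultimately show ?thesis by (simp add: info_def)
qed

lemma feasible_times_nonempty: "feasible_times I \<noteq> {}"
proof -
  have "(\<lambda>_. 0) \<in> feasible_times I"
    by (simp add: feasible_times_def)
  then show ?thesis by blast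
qed

lemma bdd_above_opt:
  "bdd_above ((\<lambda>\<tau>. \<Sum>i\<in>articles I. info I i (\<tau> i)) ` feasible_times I)"
proof (rule bdd_aboveI2)
  fix \<tau> assume "\<tau> \<in> feasible_times I"
  then show "(\<Sum>i\<in>articles I. info I i (\<tau> i)) \<le>
      (\<Sum>i\<in>articles I. 2 * (\<Sum>j\<le>len I i. real (rate I i j)))"
    by (intro sum_mono info_le) (auto simp: feasible_times_def)
qed

lemma accuracy_is_least:
  assumes "rao_instance I"
  shows "accuracy_bound I (accuracy I)"
    and "\<And>C. accuracy_bound I C \<Longrightarrow> accuracy I \<le> C"
proof -
  define a where "a i = (\<Sum>j=1..len I i. real (rate I i j)) / real (len I i)" for i
  have pos: "0 < a i" if i: "i \<in> articles I" for i
  proof -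
    have l: "0 < len I i" and r: "rate I i ` {1..len I i} \<subseteq> {1..hint I i}"
      using assms i by (auto simp: rao_instance_def)
    have "0 < real (rate I i j)" if "j \<in> {1..len I i}" for j
      using r that by fastforce
    then have "0 < (\<Sum>j=1..len I i. real (rate I i j))"
      using l by (intro sum_pos) auto
    then show ?thesis using l by (simp add: a_def)
  qed
  define M where "M = Max (insert 1 ((\<lambda>i. real (hint I i) / a i) ` articles I))"
  have iff: "accuracy_bound I C \<longleftrightarrow> M \<le> C" for C
  proof -
    have "accuracy_bound I C \<longleftrightarrow> 1 \<le> C \<and> (\<forall>i\<in>articles I. real (hint I i) \<le> C * a i)"
      unfolding accuracy_bound_def a_def ..
    then show ?thesis using pos by (auto simp: M_def pos_divide_le_eq)
  qed
  have "accuracy I = M"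
    unfolding accuracy_def iff by (rule Least_equality) auto
  then show "accuracy_bound I (accuracy I)" "\<And>C. accuracy_bound I C \<Longrightarrow> accuracy I \<le> C"
    by (auto simp: iff)
qed

lemma ex_threshold:
  assumes "rao_instance I" "standing_assumptions g I" "0 < g" "X \<subseteq> articles I"
  shows "\<exists>\<rho>. is_threshold g I X \<rho>"
proof -
  define w where "w = short_len g I"
  define h where "h i = real (hint I i)" for i
  define c where "c = real (budget I) / 2"
  have fin: "finite X" using assms(4) finite_articles by (rule finite_subset)
  have w: "0 < w i" if "i \<in> X" for i
    using assms that by (auto simp: w_def short_len_def rao_instance_def)
  have h: "0 < h i" if "i \<in> X" for i
    using assms that by (auto simp: h_def rao_instance_def)
  have inj: "h i = h j \<Longrightarrow> i = j" if "i \<in> X" "j \<in> X" for i j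
    proof -
    have "inj_on (hint I) (articles I)" using assms(2) by (simp add: standing_assumptions_def)
    then show "h i = h j \<Longrightarrow> i = j" using assms(4) that by (auto simp: h_def dest: inj_onD)
  qed
  have goal: ?thesis if "knapsack_optimal X w (\<lambda>i. w i * h i) c x"
      "\<forall>i\<in>X. (h i > \<rho> \<longrightarrow> x i = 1) \<and> (h i < \<rho> \<longrightarrow> x i = 0)" for x \<rho>
    using that unfolding is_threshold_def w_def h_def c_def by blast
  have c0: "0 \<le> c" by (simp add: c_def)
  show ?thesis
  proof (cases "(\<Sum>i\<in>X. w i) \<le> c")
    case True
    have "knapsack_optimal X w (\<lambda>i. w i * h i) c (\<lambda>_. 1)"
      unfolding knapsack_optimal_def knapsack_feasible_def
    proof (intro conjI allI impI)
      fix y assume "(\<forall>i\<in>X. 0 \<le> y i \<and> y i \<le> 1) \<and> (\<Sum>i\<in>X. w i * y i) \<le> c"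
      then show "(\<Sum>i\<in>X. w i * h i * y i) \<le> (\<Sum>i\<in>X. w i * h i * 1)"
        using w h by (intro sum_mono mult_left_mono) (auto simp: less_imp_le)
    qed (use True in auto)
    then show ?thesis by (rule goal[where \<rho> = 0]) (use h in force)
  next
    case False
    define G where "G k = (\<Sum>i\<in>{i\<in>X. h k \<le> h i}. w i)" for k
    define K where "K = {k\<in>X. c < G k}"
    have "X \<noteq> {}" using False c0 by auto
    then obtain m where m: "m \<in> X" "\<forall>i\<in>X. h m \<le> h i"
      using arg_min_if_finite[of X h] fin by (meson not_less)
    have "{i\<in>X. h m \<le> h i} = X" using m by auto
    then have "m \<in> K" using m False by (simp add: K_def G_def)
    moreover have finK: "finite K" using fin by (simp add: K_def)
    ultimately obtain k where k: "k \<in> K" and kmax: "\<And>j. j \<in> K \<Longrightarrow> h j \<le> h k"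
      using arg_min_if_finite[of K "\<lambda>i. - h i"] by (metis empty_iff neg_less_iff_less not_less)
    have kX: "k \<in> X" using k by (simp add: K_def)
    define A where "A = {i\<in>X. h k < h i}"
    have finA: "finite A" using fin by (simp add: A_def)
    have A: "(\<Sum>i\<in>A. w i) \<le> c"
    proof (cases "A = {}")
      case False
      then obtain j where j: "j \<in> A" and jmin: "\<And>i. i \<in> A \<Longrightarrow> h j \<le> h i"
        using arg_min_if_finite[of A h] finA by (metis not_less)
      have "{i\<in>X. h j \<le> h i} = A" using j jmin by (auto simp: A_def)
      moreover have "j \<notin> K" using j kmax by (force simp: A_def)
      ultimately show ?thesis using j by (simp add: K_def G_def A_def)
    qed (use c0 in auto)
    have "{i\<in>X. h k \<le> h i} = insert k A"
    proof (intro set_eqI iffI)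
      fix i assume "i \<in> {i\<in>X. h k \<le> h i}"
      then show "i \<in> insert k A" using inj[of i k] kX by (cases "h k = h i") (auto simp: A_def)
    qed (use kX in \<open>auto simp: A_def\<close>)
    moreover have "k \<notin> A" by (simp add: A_def)
    ultimately have Gk: "c < w k + (\<Sum>i\<in>A. w i)"
      using k finA by (simp add: K_def G_def)
    define x where "x i = (if h k < h i then 1 else if i = k then (c - (\<Sum>i\<in>A. w i)) / w k else 0)" for i
    have xk: "x k = (c - (\<Sum>i\<in>A. w i)) / w k" by (simp add: x_def)
    have wk: "0 < w k" using w kX by simp
    have xle: "0 \<le> x i \<and> x i \<le> 1" if "i \<in> X" for i
      using A Gk wk by (auto simp: x_def field_simps)
    have "(\<Sum>i\<in>X. w i * x i) = (\<Sum>i\<in>insert k A. w i * x i)"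
      using fin kX by (intro sum.mono_neutral_right) (auto simp: A_def x_def)
    also have "\<dots> = w k * x k + (\<Sum>i\<in>A. w i)"
      using finA \<open>k \<notin> A\<close> by (simp add: A_def x_def)
    also have "\<dots> = c" using wk by (simp add: xk)
    finally have sumx: "(\<Sum>i\<in>X. w i * x i) = c" .
    have "knapsack_optimal X w (\<lambda>i. w i * h i) c x"
      unfolding knapsack_optimal_def knapsack_feasible_def
    proof (intro conjI allI impI)
      fix y assume y: "(\<forall>i\<in>X. 0 \<le> y i \<and> y i \<le> 1) \<and> (\<Sum>i\<in>X. w i * y i) \<le> c"
      have "(\<Sum>i\<in>X. w i * ((h i - h k) * (y i - x i))) \<le> 0"
      proof (rule sum_nonpos)
        fix i assume i: "i \<in> X"
        consider "h k < h i" | "h i < h k" | "i = k" using inj[OF i kX] by (meson linorder_cases)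
        then have "(h i - h k) * (y i - x i) \<le> 0"
        proof cases
          case 1 then show ?thesis using y i by (auto simp: x_def mult_le_0_iff)
        next
          case 2 then show ?thesis using y i by (auto simp: x_def mult_le_0_iff)
        qed simp
        then show "w i * ((h i - h k) * (y i - x i)) \<le> 0"
          using w[OF i] by (simp add: mult_le_0_iff)
      qed
      moreover have "(\<Sum>i\<in>X. w i * ((h i - h k) * (y i - x i))) =
          (\<Sum>i\<in>X. w i * h i * y i) - (\<Sum>i\<in>X. w i * h i * x i)
            - h k * ((\<Sum>i\<in>X. w i * y i) - (\<Sum>i\<in>X. w i * x i))"
        unfolding sum_subtractf[symmetric] sum_distrib_left
        by (intro sum.cong) (auto simp: algebra_simps)
      moreover have "h k * ((\<Sum>i\<in>X. w i * y i) - (\<Sum>i\<in>X. w i * x i)) \<le> 0"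
        using y sumx h[OF kX] by (simp add: mult_le_0_iff)
      ultimately show "(\<Sum>i\<in>X. w i * h i * y i) \<le> (\<Sum>i\<in>X. w i * h i * x i)"
        by linarith
    qed (use xle sumx in auto)
    then show ?thesis by (rule goal[where \<rho> = "h k"]) (auto simp: x_def)
  qed
qed

lemma ex_threshold_rule:
  assumes "rao_instance I" "standing_assumptions g I" "0 < g"
  shows "\<exists>\<rho>. threshold_rule g I \<rho>"
  using ex_threshold[OF assms] unfolding threshold_rule_def by metis

end

theory Submission
  imports Defs
begin

text \<open>
  Write \<open>w i\<close> for the truncated length \<open>min (g T) (t i)\<close>. The sample \<open>X\<close> is a uniformly random
  set of articles. Let \<open>P\<close> be a maximal set of articles of highest hints with weight at most
  \<open>3T/2\<close>; its weight is at least \<open>3T/2 - gT\<close>, so by Chebyshev's inequality the part of \<open>P\<close> in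
  \<open>X\<close> has weight more than \<open>T/2\<close> with probability at least \<open>0.85\<close>. In that case every article
  with hint above the threshold lies in \<open>P\<close>, so those outside \<open>X\<close> have total weight below \<open>T\<close>,
  and the algorithm reads each of them for its full truncated length, whatever the arrival order.
  Moreover the threshold does not exceed the hint of any article \<open>i\<close> for which the articles of
  higher hint weigh less than \<open>T/2\<close>; let \<open>D\<close> be the set of these articles. Each of them is thus
  read with probability at least \<open>0.85 - 1/2\<close>, which yields the fraction \<open>0.35 / C\<close> of the hinted
  value of \<open>D\<close>. Scaling an optimal solution by \<open>g\<close> gives reading times at most \<open>w\<close> with total at
  most \<open>gT \<le> T/2\<close>, so \<open>g Opt\<close> is at most the hinted value of \<open>D\<close>. Finally
  \<open>1 / (0.35 g) < 133\<close>.
\<close>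

section \<open>The random sample\<close>

lemma ex_permutes_image_eq:
  assumes "finite A" "X \<subseteq> A" "Y \<subseteq> A" "card X = card Y"
  obtains \<sigma> where "\<sigma> permutes A" "\<sigma> ` X = Y"
proof -
  have fin: "finite X" "finite Y" "finite (A - X)" "finite (A - Y)"
    using assms by (auto intro: finite_subset)
  obtain f where f: "bij_betw f X Y"
    using finite_same_card_bij fin assms(4) by blast
  have "card (A - X) = card (A - Y)"
    using assms fin by (simp add: card_Diff_subset)
  then obtain f' where f': "bij_betw f' (A - X) (A - Y)"
    using finite_same_card_bij fin by blast
  define \<sigma> where "\<sigma> i = (if i \<in> X then f i else if i \<in> A then f' i else i)" for i
  have "bij_betw \<sigma> X Y"
    using f by (rule bij_betw_cong[THEN iffD1, rotated]) (simp add: \<sigma>_def)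
  moreover have "bij_betw \<sigma> (A - X) (A - Y)"
    using f' by (rule bij_betw_cong[THEN iffD1, rotated]) (simp add: \<sigma>_def)
  ultimately have "bij_betw \<sigma> (X \<union> (A - X)) (Y \<union> (A - Y))"
    by (rule bij_betw_combine) auto
  moreover have "X \<union> (A - X) = A" "Y \<union> (A - Y) = A"
    using assms by auto
  ultimately have "bij_betw \<sigma> A A" by simp
  then have "\<sigma> permutes A"
    using assms(2) by (intro bij_imp_permutes) (auto simp: \<sigma>_def)
  moreover have "\<sigma> ` X = Y"
    using \<open>bij_betw \<sigma> X Y\<close> by (simp add: bij_betw_def)
  ultimately show ?thesis by (rule that)
qed

text \<open>Permutations of \<open>A\<close> act transitively on the subsets of a given size, so
  invariance makes \<open>M\<close> constant on each size. The binomial law of the size then leaves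
  the mass \<open>(1/2) ^ card A\<close> for every single subset.\<close>

lemma pmf_eq_pmf_of_set_PowI:
  fixes M :: "'a set pmf"
  assumes A: "finite A" and set: "set_pmf M \<subseteq> Pow A"
    and inv: "\<And>\<sigma>. \<sigma> permutes A \<Longrightarrow> map_pmf (image \<sigma>) M = M"
    and card: "map_pmf card M = binomial_pmf (card A) (1/2)"
  shows "M = pmf_of_set (Pow A)"
proof (rule pmf_eqI)
  fix X
  show "pmf M X = pmf (pmf_of_set (Pow A)) X"
  proof (cases "X \<subseteq> A")
    case False
    have "X \<notin> set_pmf M" using False set by auto
    then have "pmf M X = 0" by (simp add: set_pmf_iff)
    moreover have "pmf (pmf_of_set (Pow A)) X = 0"
      using False A by (subst pmf_of_set) (auto simp: indicator_def)
    ultimately show ?thesis by simp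
  next
    case True
    define k where "k = card X"
    define S where "S = {Y. Y \<subseteq> A \<and> card Y = k}"
    have k: "k \<le> card A" using True A by (simp add: k_def card_mono)
    have eq: "pmf M Y = pmf M X" if "Y \<in> S" for Y
    proof -
      obtain \<sigma> where \<sigma>: "\<sigma> permutes A" "\<sigma> ` X = Y"
        using ex_permutes_image_eq[OF A True, of Y] \<open>Y \<in> S\<close> by (auto simp: S_def k_def)
      then have "inj (image \<sigma>)" by (metis injI inj_image_eq_iff permutes_inj)
      then have "pmf (map_pmf (image \<sigma>) M) (\<sigma> ` X) = pmf M X" by (rule pmf_map_inj')
      then show ?thesis using \<sigma> inv by simp
    qed
    have "pmf (binomial_pmf (card A) (1/2)) k = measure (measure_pmf M) (card -` {k})"
      by (simp add: card[symmetric] pmf_map)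
    \<comment> \<open>The two events differ only by sets outside \<open>Pow A\<close>, which have
      probability zero.\<close>
    also have "\<dots> = measure (measure_pmf M) S"
      using set by (intro measure_eq_AE) (auto simp: AE_measure_pmf_iff S_def)
    also have "\<dots> = (\<Sum>Y\<in>S. pmf M Y)"
      using A by (intro measure_measure_pmf_finite) (simp add: S_def)
    also have "\<dots> = real (card A choose k) * pmf M X"
      using A eq by (simp add: S_def n_subsets)
    finally have "real (card A choose k) * pmf M X = real (card A choose k) * (1/2) ^ card A"
      using k by (simp add: power_add[symmetric])
    then have "pmf M X = (1/2) ^ card A" using k by simp
    then show ?thesis using True A by (subst pmf_of_set) (auto simp: card_Pow power_one_over)
  qed
qed

text \<open>Relabelling the articles commutes with sampling; this equivariance supplies the
  invariance demanded by \<open>pmf_eq_pmf_of_set_PowI\<close>.\<close>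

lemma sample_comp:
  assumes "\<sigma> permutes articles I"
  shows "sample I (\<pi> \<circ> inv \<sigma>) r = \<sigma> ` sample I \<pi> r"
proof (intro set_eqI iffI)
  fix i assume "i \<in> sample I (\<pi> \<circ> inv \<sigma>) r"
  then have "inv \<sigma> i \<in> sample I \<pi> r"
    using permutes_in_image[OF permutes_inv[OF assms]] by (simp add: sample_def)
  then show "i \<in> \<sigma> ` sample I \<pi> r"
    using permutes_inverses(1)[OF assms, of i] by (metis image_eqI)
next
  fix i assume "i \<in> \<sigma> ` sample I \<pi> r"
  then show "i \<in> sample I (\<pi> \<circ> inv \<sigma>) r"
    using permutes_in_image[OF assms] permutes_inverses(2)[OF assms] by (auto simp: sample_def)
qed

lemma card_sample:
  assumes "\<pi> permutes articles I" "r \<le> num_articles I"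
  shows "card (sample I \<pi> r) = r"
proof -
  have "\<pi> ` sample I \<pi> r = {1..r}"
  proof (intro set_eqI iffI)
    fix k assume "k \<in> {1..r}"
    then have "k \<in> \<pi> ` articles I"
      using assms permutes_image[OF assms(1)] by (auto simp: articles_def)
    then show "k \<in> \<pi> ` sample I \<pi> r" using \<open>k \<in> {1..r}\<close> by (auto simp: sample_def)
  next
    fix k assume "k \<in> \<pi> ` sample I \<pi> r"
    then show "k \<in> {1..r}"
      using permutes_in_image[OF assms(1)] by (auto simp: sample_def articles_def)
  qed
  then show ?thesis
    using card_image[OF permutes_inj_on[OF assms(1)], of "sample I \<pi> r"] by simp
qed

text \<open>Composition with \<open>inv \<sigma>\<close> preserves the uniform law of the arrival
  order, so the law of the sample is invariant under relabelling, and its size is the binomial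
  \<open>r\<close>. Expectations of functions of the sample thereby become averages over all sets of
  articles.\<close>

lemma map_pmf_sample:
  "map_pmf (\<lambda>(\<pi>, r). sample I \<pi> r)
     (pair_pmf (pmf_of_set {\<pi>. \<pi> permutes articles I}) (binomial_pmf (num_articles I) (1/2)))
   = pmf_of_set (Pow (articles I))"
  (is "map_pmf ?s (pair_pmf ?P ?B) = _")
proof (rule pmf_eq_pmf_of_set_PowI)
  have P: "finite {\<pi>. \<pi> permutes articles I}" "{\<pi>. \<pi> permutes articles I} \<noteq> {}"
    using permutes_id[of "articles I"] by (auto simp: finite_permutations simp del: permutes_id)
  have cardA: "card (articles I) = num_articles I" by (simp add: articles_def)
  show "finite (articles I)" by simp
  show "set_pmf (map_pmf ?s (pair_pmf ?P ?B)) \<subseteq> Pow (articles I)"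
    by (auto simp: sample_def)
  show "map_pmf (image \<sigma>) (map_pmf ?s (pair_pmf ?P ?B)) = map_pmf ?s (pair_pmf ?P ?B)"
    if \<sigma>: "\<sigma> permutes articles I" for \<sigma>
  proof -
    have "bij_betw (\<lambda>\<pi>. \<pi> \<circ> inv \<sigma>) {\<pi>. \<pi> permutes articles I} {\<pi>. \<pi> permutes articles I}"
      by (rule bij_betw_byWitness[where f' = "\<lambda>\<pi>. \<pi> \<circ> \<sigma>"])
        (use \<sigma> permutes_inv[OF \<sigma>] in \<open>auto intro: permutes_compose simp: o_assoc[symmetric] permutes_inv_o\<close>)
    then have inv: "map_pmf (\<lambda>\<pi>. \<pi> \<circ> inv \<sigma>) ?P = ?P"
      using P by (intro map_pmf_of_set_bij_betw) auto
    have "map_pmf (image \<sigma>) (map_pmf ?s (pair_pmf ?P ?B)) =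
        map_pmf ?s (map_pmf (apfst (\<lambda>\<pi>. \<pi> \<circ> inv \<sigma>)) (pair_pmf ?P ?B))"
      by (simp add: map_pmf_comp sample_comp[OF \<sigma>] case_prod_beta)
    also have "map_pmf (apfst (\<lambda>\<pi>. \<pi> \<circ> inv \<sigma>)) (pair_pmf ?P ?B) = pair_pmf ?P ?B"
      by (simp add: pair_map_pmf1[symmetric] inv)
    finally show ?thesis .
  qed
  have "map_pmf card (map_pmf ?s (pair_pmf ?P ?B)) = map_pmf snd (pair_pmf ?P ?B)"
    unfolding map_pmf_comp using P by (intro map_pmf_cong) (auto simp: card_sample)
  then show "map_pmf card (map_pmf ?s (pair_pmf ?P ?B)) = binomial_pmf (card (articles I)) (1/2)"
    by (simp add: map_snd_pair_pmf cardA)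
qed

section \<open>Second moments and Chebyshev's inequality for random subsets\<close>

lemma sum_Pow_insert:
  assumes "finite A" "a \<notin> A"
  shows "(\<Sum>X\<in>Pow (insert a A). f X) = (\<Sum>X\<in>Pow A. f X + f (insert a X))"
proof -
  have "inj_on (insert a) (Pow A)" using assms(2) by (intro inj_onI) (auto simp: insert_ident)
  moreover have "Pow A \<inter> insert a ` Pow A = {}" using assms(2) by auto
  ultimately show ?thesis
    using assms(1) by (simp add: Pow_insert sum.union_disjoint sum.reindex sum.distrib)
qed

text \<open>Independent uniform signs are uncorrelated. In the induction, the choices without and
  with \<open>b\<close> contribute \<open>S X - a b\<close> and \<open>S X + a b\<close>, and the
  cross terms of the squares cancel.\<close>

lemma sum_Pow_signed_sum_square:
  fixes a :: "'a \<Rightarrow> real"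
  assumes "finite A"
  shows "(\<Sum>X\<in>Pow A. (\<Sum>i\<in>A. if i \<in> X then a i else - a i)\<^sup>2) = 2 ^ card A * (\<Sum>i\<in>A. (a i)\<^sup>2)"
  using assms
proof (induction A)
  case (insert b A)
  define S where "S X = (\<Sum>i\<in>A. if i \<in> X then a i else - a i)" for X
  have S: "(\<Sum>i\<in>A. if i \<in> insert b X then a i else - a i) = S X" for X
    unfolding S_def using insert.hyps by (intro sum.cong) auto
  have "(\<Sum>X\<in>Pow (insert b A). (\<Sum>i\<in>insert b A. if i \<in> X then a i else - a i)\<^sup>2) =
      (\<Sum>X\<in>Pow A. (S X - a b)\<^sup>2 + (S X + a b)\<^sup>2)"
    unfolding sum_Pow_insert[OF insert.hyps]
  proof (intro sum.cong refl arg_cong2[where f = "(+)"])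
    fix X assume "X \<in> Pow A"
    then show "(\<Sum>i\<in>insert b A. if i \<in> X then a i else - a i)\<^sup>2 = (S X - a b)\<^sup>2"
      using insert.hyps by (auto simp: S_def)
    show "(\<Sum>i\<in>insert b A. if i \<in> insert b X then a i else - a i)\<^sup>2 = (S X + a b)\<^sup>2"
      using insert.hyps S[of X] by (simp add: add.commute)
  qed
  also have "\<dots> = (\<Sum>X\<in>Pow A. 2 * (S X)\<^sup>2 + 2 * (a b)\<^sup>2)"
    by (simp add: power2_eq_square algebra_simps)
  also have "\<dots> = 2 ^ card (insert b A) * (\<Sum>i\<in>insert b A. (a i)\<^sup>2)"
    using insert by (simp add: sum.distrib sum_distrib_left[symmetric] S_def card_Pow algebra_simps)
  finally show ?case .
qed simp

text \<open>The signed sum is twice the deviation of the weight in \<open>X\<close> from its mean,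
  half the total weight.\<close>

lemma sum_signed_eq:
  fixes a :: "'a \<Rightarrow> real"
  assumes "finite A"
  shows "(\<Sum>i\<in>A. if i \<in> X then a i else - a i) = 2 * (\<Sum>i\<in>A \<inter> X. a i) - (\<Sum>i\<in>A. a i)"
proof -
  have "(\<Sum>i\<in>A. if i \<in> X then a i else - a i) = (\<Sum>i\<in>A. 2 * (if i \<in> X then a i else 0) - a i)"
    by (intro sum.cong) auto
  then show ?thesis
    using assms by (simp add: sum_subtractf sum_distrib_left[symmetric] sum.inter_restrict)
qed

text \<open>Chebyshev's inequality for the weight in \<open>P\<close> of a uniformly random subset of \<open>A\<close>,
  scaled by the number of subsets.\<close>

lemma card_subsets_low_weight:
  fixes w :: "'a \<Rightarrow> real"
  assumes "finite A" "P \<subseteq> A" "0 \<le> d" "2 * c + d \<le> (\<Sum>i\<in>P. w i)"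
  shows "real (card {X \<in> Pow A. (\<Sum>i\<in>X \<inter> P. w i) \<le> c}) * d\<^sup>2 \<le> 2 ^ card A * (\<Sum>i\<in>P. (w i)\<^sup>2)"
proof -
  \<comment> \<open>Extending the weights by zero lets the subsets range over \<open>Pow A\<close>
    although only the weight in \<open>P\<close> counts.\<close>
  define a where "a i = (if i \<in> P then w i else 0)" for i
  define S where "S X = (\<Sum>i\<in>A. if i \<in> X then a i else - a i)" for X
  define B where "B = {X \<in> Pow A. (\<Sum>i\<in>X \<inter> P. w i) \<le> c}"
  have sumP: "(\<Sum>i\<in>A \<inter> Y. a i) = (\<Sum>i\<in>Y \<inter> P. w i)" if "Y \<subseteq> A" for Y
    using assms(1) that finite_subset[OF that assms(1)]
    by (simp add: a_def sum.inter_restrict[symmetric] Int_absorb1)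
  have *: "d\<^sup>2 \<le> (S X)\<^sup>2" if "X \<in> B" for X
  proof -
    have "S X = 2 * (\<Sum>i\<in>X \<inter> P. w i) - (\<Sum>i\<in>P. w i)"
      using assms(1,2) sumP[of X] sumP[of A] that
      by (simp add: S_def sum_signed_eq B_def Int_absorb1)
    then have "d \<le> - S X" using assms(4) that by (simp add: B_def)
    then have "d\<^sup>2 \<le> (- S X)\<^sup>2" using assms(3) by (rule power_mono)
    then show ?thesis by simp
  qed
  have "real (card B) * d\<^sup>2 = (\<Sum>X\<in>B. d\<^sup>2)" by simp
  also have "\<dots> \<le> (\<Sum>X\<in>B. (S X)\<^sup>2)" by (intro sum_mono *)
  also have "\<dots> \<le> (\<Sum>X\<in>Pow A. (S X)\<^sup>2)"
    using assms(1) by (intro sum_mono2) (auto simp: B_def)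
  also have "\<dots> = 2 ^ card A * (\<Sum>i\<in>A. (a i)\<^sup>2)"
    unfolding S_def by (rule sum_Pow_signed_sum_square[OF assms(1)])
  also have "(\<Sum>i\<in>A. (a i)\<^sup>2) = (\<Sum>i\<in>P. (w i)\<^sup>2)"
    using assms(1,2) by (intro sum.mono_neutral_cong_right) (auto simp: a_def)
  finally show ?thesis by (simp add: B_def)
qed

lemma card_subsets_notin:
  assumes "finite A" "i \<in> A"
  shows "2 * card {X \<in> Pow A. i \<notin> X} = 2 ^ card A"
proof -
  have "{X \<in> Pow A. i \<notin> X} = Pow (A - {i})" by auto
  moreover have "card A = Suc (card (A - {i}))" using assms by (rule card.remove)
  ultimately show ?thesis using assms(1) by (simp only: card_Pow finite_Diff power_Suc)
qed

text \<open>The bound \<open>1.4785\<close> is \<open>3/2 - 0.0215\<close>.\<close>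

lemma card_subsets_notin_high_weight:
  fixes w :: "'a \<Rightarrow> real"
  assumes A: "finite A" "P \<subseteq> A" "i \<in> A" and T: "0 < T"
    and w: "\<And>i. i \<in> P \<Longrightarrow> 0 \<le> w i \<and> w i \<le> 0.0215 * T"
    and P: "1.4785 * T \<le> (\<Sum>i\<in>P. w i)" "(\<Sum>i\<in>P. w i) \<le> 3/2 * T"
  shows "0.35 * 2 ^ card A \<le> real (card {X \<in> Pow A. i \<notin> X \<and> T/2 < (\<Sum>i\<in>X \<inter> P. w i)})"
proof -
  define N where "N = {X \<in> Pow A. i \<notin> X}"
  define B where "B = {X \<in> Pow A. (\<Sum>i\<in>X \<inter> P. w i) \<le> T/2}"
  \<comment> \<open>Chebyshev with \<open>c = T/2\<close> leaves the slack
    \<open>d = 1.4785 * T - 2 * (T/2)\<close>.\<close>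
  have "real (card B) * (0.4785 * T)\<^sup>2 \<le> 2 ^ card A * (\<Sum>i\<in>P. (w i)\<^sup>2)"
    unfolding B_def using assms by (intro card_subsets_low_weight) auto
  also have "(\<Sum>i\<in>P. (w i)\<^sup>2) \<le> (\<Sum>i\<in>P. 0.0215 * T * w i)"
    unfolding power2_eq_square using w by (intro sum_mono mult_right_mono) auto
  also have "\<dots> \<le> 0.0215 * T * (3/2 * T)"
    unfolding sum_distrib_left[symmetric] using P T by (intro mult_left_mono) auto
  also have "\<dots> \<le> 0.15 * (0.4785 * T)\<^sup>2"
    by (simp add: power2_eq_square)
  finally have "real (card B) * (0.4785 * T)\<^sup>2 \<le> (0.15 * 2 ^ card A) * (0.4785 * T)\<^sup>2"
    by (simp add: mult_ac)
  then have B: "real (card B) \<le> 0.15 * 2 ^ card A"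
    by (rule mult_right_le_imp_le) (use T in simp)
  have N: "2 * real (card N) = 2 ^ card A"
    using arg_cong[OF card_subsets_notin[OF A(1,3)], of real] by (simp add: N_def)
  have "card N \<le> card ({X \<in> Pow A. i \<notin> X \<and> T/2 < (\<Sum>i\<in>X \<inter> P. w i)} \<union> B)"
    using A(1) by (intro card_mono) (auto simp: N_def B_def not_le)
  also have "\<dots> \<le> card {X \<in> Pow A. i \<notin> X \<and> T/2 < (\<Sum>i\<in>X \<inter> P. w i)} + card B"
    by (rule card_Un_le)
  finally have "real (card N) \<le>
      real (card {X \<in> Pow A. i \<notin> X \<and> T/2 < (\<Sum>i\<in>X \<inter> P. w i)}) + real (card B)"
    by linarith
  \<comment> \<open>This is the share \<open>1/2 - 0.15 = 7/20\<close>, cleared of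
    denominators.\<close>
  then have "7 * 2 ^ card A \<le> 20 * real (card {X \<in> Pow A. i \<notin> X \<and> T/2 < (\<Sum>i\<in>X \<inter> P. w i)})"
    using B N by simp
  then show ?thesis by simp
qed

section \<open>Information gained from an article\<close>

lemma info_nonneg: "0 \<le> info I i \<tau>"
  by (simp add: info_def sum_nonneg)

lemma info_le_hint:
  assumes "rao_instance I" "i \<in> articles I" "0 \<le> \<tau>" "\<tau> \<le> real (len I i)"
  shows "info I i \<tau> \<le> \<tau> * real (hint I i)"
proof -
  define m where "m = nat \<lfloor>\<tau>\<rfloor>"
  have rate: "real (rate I i j) \<le> real (hint I i)" if "j \<in> {1..len I i}" for j
    using assms(1,2) that by (fastforce simp: rao_instance_def)
  have m: "m \<le> len I i" using assms(3,4) unfolding m_def by linarith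
  have \<tau>: "\<tau> = real m + frac \<tau>" using assms(3) by (simp add: m_def frac_def)
  have "(\<Sum>j=1..m. real (rate I i j)) \<le> (\<Sum>j=1..m. real (hint I i))"
    using m by (intro sum_mono rate) auto
  moreover have "real (rate I i (nat \<lceil>\<tau>\<rceil>)) * frac \<tau> \<le> real (hint I i) * frac \<tau>"
  \<comment> \<open>At \<open>\<tau> = 0\<close> the rate is evaluated at index 0, where nothing
    bounds it, but the factor \<open>frac \<tau>\<close> vanishes.\<close>
  proof (cases "\<tau> = 0")
    case False
    then have "nat \<lceil>\<tau>\<rceil> \<in> {1..len I i}" using assms(3,4) by (auto simp: nat_le_iff ceiling_le_iff) linarith
    then show ?thesis by (intro mult_right_mono rate) auto
  qed simp
  ultimately have "info I i \<tau> \<le> (real m + frac \<tau>) * real (hint I i)"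
    by (simp add: info_def m_def algebra_simps)
  then show ?thesis using \<tau> by simp
qed

text \<open>For non-increasing rates the average over a prefix is at least the average over the
  whole article; the inequality is stated without division.\<close>

lemma info_ge_average:
  assumes anti: "antimono_on {1..len I i} (rate I i)"
    and \<tau>: "0 \<le> \<tau>" "\<tau> \<le> real (len I i)"
  shows "\<tau> * (\<Sum>j=1..len I i. real (rate I i j)) \<le> real (len I i) * info I i \<tau>"
proof (cases "\<tau> = real (len I i)")
  case True
  then show ?thesis by (simp add: info_def frac_def)
next
  case False
  define t where "t = len I i"
  define m where "m = nat \<lfloor>\<tau>\<rfloor>"
  define f where "f = frac \<tau>"
  \<comment> \<open>The rate of the step in which reading stops separates the others: earlier rates
    are at least \<open>a\<close>, later ones at most \<open>a\<close>.\<close>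
  define a where "a = real (rate I i (Suc m))"
  define S where "S = (\<Sum>j=1..m. real (rate I i j))"
  have \<tau>_eq: "\<tau> = real m + f" using \<tau>(1) by (simp add: m_def f_def frac_def)
  have m: "m < t" using \<tau> False unfolding m_def t_def by linarith
  have mono: "real (rate I i k) \<le> real (rate I i j)" if "1 \<le> j" "j \<le> k" "k \<le> t" for j k
    using anti that by (auto simp: monotone_on_def t_def)
  \<comment> \<open>For integral \<open>\<tau>\<close> the ceiling is \<open>m\<close> rather than
    \<open>Suc m\<close>, which is harmless because \<open>f = 0\<close>.\<close>
  have info: "info I i \<tau> = S + a * f"
  proof (cases "f = 0")
    case False
    then have "nat \<lceil>\<tau>\<rceil> = Suc m"
      using \<tau>(1) unfolding m_def f_def frac_def by linarith
    then show ?thesis by (simp add: info_def S_def a_def f_def m_def)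
  qed (simp add: info_def S_def f_def m_def)
  have Sm: "real m * a \<le> S"
  proof -
    have "(\<Sum>j=1..m. a) \<le> S" unfolding S_def a_def using m by (intro sum_mono mono) auto
    then show ?thesis by simp
  qed
  have "{1..t} = {1..m} \<union> {Suc m..t}" using m by auto
  then have "(\<Sum>j=1..t. real (rate I i j)) = S + (\<Sum>j=Suc m..t. real (rate I i j))"
    unfolding S_def by (simp add: sum.union_disjoint)
  also have "(\<Sum>j=Suc m..t. real (rate I i j)) \<le> (\<Sum>j=Suc m..t. a)"
    unfolding a_def by (intro sum_mono mono) auto
  also have "(\<Sum>j=Suc m..t. a) = (real t - real m) * a"
    using m by (simp add: of_nat_diff)
  finally have "\<tau> * (\<Sum>j=1..t. real (rate I i j)) \<le> \<tau> * (S + (real t - real m) * a)"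
    using \<tau>(1) by (intro mult_left_mono) auto
  \<comment> \<open>The subtracted product has two nonnegative factors.\<close>
  also have "\<dots> = real t * (S + a * f) - (S - real m * a) * (real t - \<tau>)"
    by (simp add: \<tau>_eq algebra_simps)
  also have "\<dots> \<le> real t * (S + a * f)"
    using Sm \<tau>(2) by (simp add: t_def)
  finally show ?thesis by (simp add: info t_def)
qed

text \<open>The accuracy compares the hint with the average rate of the whole article, and reading a
  prefix does at least as well as that average.\<close>

lemma accuracy_mult_info_ge:
  assumes I: "rao_instance I" and i: "i \<in> articles I"
    and anti: "antimono_on {1..len I i} (rate I i)"
    and \<tau>: "0 \<le> \<tau>" "\<tau> \<le> real (len I i)"
  shows "\<tau> * real (hint I i) \<le> accuracy I * info I i \<tau>"
proof -
  define t where "t = real (len I i)"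
  define R where "R = (\<Sum>j=1..len I i. real (rate I i j))"
  have acc: "accuracy_bound I (accuracy I)" by (rule accuracy_is_least[OF I])
  have t: "0 < t" using I i by (auto simp: rao_instance_def t_def)
  have "real (hint I i) \<le> accuracy I * (R / t)"
    using acc i by (simp add: accuracy_bound_def R_def t_def)
  then have "\<tau> * real (hint I i) \<le> \<tau> * (accuracy I * (R / t))"
    using \<tau>(1) by (rule mult_left_mono)
  also have "\<dots> = accuracy I * (\<tau> * R / t)" by simp
  also have "\<dots> \<le> accuracy I * info I i \<tau>"
    using info_ge_average[OF anti \<tau>] acc t
    by (intro mult_left_mono) (auto simp: R_def t_def accuracy_bound_def field_simps)
  finally show ?thesis .
qed

section \<open>Thresholds and reading times\<close>

lemma knapsack_optimal_sum_eq:
  fixes w h x :: "nat \<Rightarrow> real"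
  assumes opt: "knapsack_optimal X w (\<lambda>i. w i * h i) c x"
    and X: "finite X" "\<And>i. i \<in> X \<Longrightarrow> 0 < w i" "\<And>i. i \<in> X \<Longrightarrow> 0 < h i"
    and c: "c \<le> (\<Sum>i\<in>X. w i)"
  shows "(\<Sum>i\<in>X. w i * x i) = c"
proof (rule ccontr)
  assume neq: "(\<Sum>i\<in>X. w i * x i) \<noteq> c"
  have x: "\<And>i. i \<in> X \<Longrightarrow> 0 \<le> x i \<and> x i \<le> 1" "(\<Sum>i\<in>X. w i * x i) < c"
    using opt neq by (auto simp: knapsack_optimal_def knapsack_feasible_def)
  define s where "s = (\<Sum>i\<in>X. w i * x i)"
  define W where "W = (\<Sum>i\<in>X. w i)"
  \<comment> \<open>With this step size the weight of \<open>y\<close> is exactly \<open>c\<close>;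
    the denominator is positive because \<open>s < c \<le> W\<close>.\<close>
  define e where "e = (c - s) / (W - s)"
  have e: "0 < e" "e \<le> 1" "s + e * (W - s) = c"
    using x(2) c by (auto simp: e_def s_def W_def field_simps)
  define y where "y i = x i + e * (1 - x i)" for i
  have yx: "x i \<le> y i" "y i \<le> 1" if "i \<in> X" for i
    using x(1)[OF that] e mult_left_le_one_le[of "1 - x i" e] by (auto simp: y_def)
  have "(\<Sum>i\<in>X. w i * y i) = s + e * (W - s)"
    by (simp add: y_def s_def W_def algebra_simps sum.distrib sum_subtractf sum_distrib_left)
  then have "knapsack_feasible X w c y"
    using e(3) yx x(1) by (auto simp: knapsack_feasible_def intro: order_trans)
  then have "(\<Sum>i\<in>X. w i * h i * y i) \<le> (\<Sum>i\<in>X. w i * h i * x i)"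
    using opt by (simp add: knapsack_optimal_def)
  moreover have "(\<Sum>i\<in>X. w i * h i * x i) < (\<Sum>i\<in>X. w i * h i * y i)"
  proof (rule sum_strict_mono_ex1)
    show "\<forall>i\<in>X. w i * h i * x i \<le> w i * h i * y i"
      using X yx by (auto intro!: mult_left_mono mult_nonneg_nonneg less_imp_le)
    have "\<exists>i\<in>X. x i \<noteq> 1"
    proof (rule ccontr)
      assume "\<not> (\<exists>i\<in>X. x i \<noteq> 1)"
      then have "s = W" by (simp add: s_def W_def)
      then show False using x(2) c by (simp add: s_def W_def)
    qed
    then obtain i where i: "i \<in> X" "x i \<noteq> 1" by blast
    then have "x i < y i" using x(1)[OF i(1)] e(1) by (auto simp: y_def less_le)
    then show "\<exists>i\<in>X. w i * h i * x i < w i * h i * y i"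
      using i(1) X by (intro bexI[of _ i] mult_strict_left_mono) auto
  qed (rule X(1))
  ultimately show False by simp
qed

lemma short_len_pos:
  assumes "rao_instance I" "i \<in> articles I" "0 < g"
  shows "0 < short_len g I i"
  using assms by (auto simp: short_len_def rao_instance_def)

text \<open>If the threshold exceeded the hint of \<open>i\<close>, only articles of higher hint
  than \<open>i\<close> would be packed. They weigh less than half the budget, whereas an optimal
  solution fills that capacity.\<close>

lemma threshold_le_hint:
  assumes I: "rao_instance I" "0 < g" and X: "X \<subseteq> articles I"
    and thr: "is_threshold g I X \<theta>"
    and full: "real (budget I) / 2 \<le> (\<Sum>j\<in>X. short_len g I j)"
    and i: "(\<Sum>j\<in>{j\<in>articles I. hint I i < hint I j}. short_len g I j) < real (budget I) / 2"
  shows "\<theta> \<le> real (hint I i)"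
proof (rule ccontr)
  assume neg: "\<not> \<theta> \<le> real (hint I i)"
  let ?w = "short_len g I" and ?h = "\<lambda>i. real (hint I i)"
  have finX: "finite X" using X by (rule finite_subset) simp
  have w: "0 < ?w j" if "j \<in> articles I" for j using I that by (intro short_len_pos) auto
  obtain x where opt: "knapsack_optimal X ?w (\<lambda>i. ?w i * ?h i) (real (budget I) / 2) x"
    and x: "\<forall>j\<in>X. (?h j > \<theta> \<longrightarrow> x j = 1) \<and> (?h j < \<theta> \<longrightarrow> x j = 0)"
    using thr unfolding is_threshold_def by blast
  have x1: "0 \<le> x j" "x j \<le> 1" if "j \<in> X" for j
    using opt that by (auto simp: knapsack_optimal_def knapsack_feasible_def)
  have "real (budget I) / 2 = (\<Sum>j\<in>X. ?w j * x j)"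
    by (rule knapsack_optimal_sum_eq[OF opt, symmetric])
      (use finX X full w I in \<open>auto simp: rao_instance_def\<close>)
  also have "\<dots> = (\<Sum>j\<in>{j\<in>X. hint I i < hint I j}. ?w j * x j)"
    using finX x neg by (intro sum.mono_neutral_right) force+
  also have "\<dots> \<le> (\<Sum>j\<in>{j\<in>X. hint I i < hint I j}. ?w j)"
    using x1 w X by (intro sum_mono) (auto simp: mult_le_cancel_left1 dest: less_imp_le)
  also have "\<dots> \<le> (\<Sum>j\<in>{j\<in>articles I. hint I i < hint I j}. ?w j)"
    using X w by (intro sum_mono2) (auto intro: less_imp_le)
  also have "\<dots> < real (budget I) / 2" by (rule i)
  finally show False by simp
qed

text \<open>An article outside the upward closed \<open>P\<close> has a smaller hint than all of
  \<open>P\<close>. Were it at or above the threshold, all of \<open>X \<inter> P\<close> would be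
  fully packed and overflow the knapsack.\<close>

lemma ge_threshold_subset:
  assumes X: "X \<subseteq> articles I" and thr: "is_threshold g I X \<theta>" and I: "rao_instance I" "0 < g"
    and P: "P \<subseteq> articles I" "\<And>i j. i \<in> P \<Longrightarrow> j \<in> articles I \<Longrightarrow> hint I i \<le> hint I j \<Longrightarrow> j \<in> P"
    and heavy: "real (budget I) / 2 < (\<Sum>j\<in>X \<inter> P. short_len g I j)"
  shows "{j\<in>articles I. \<theta> \<le> real (hint I j)} \<subseteq> P"
proof (rule ccontr)
  assume "\<not> {j\<in>articles I. \<theta> \<le> real (hint I j)} \<subseteq> P"
  then obtain j where j: "j \<in> articles I" "\<theta> \<le> real (hint I j)" "j \<notin> P" by blast
  let ?w = "short_len g I" and ?h = "\<lambda>i. real (hint I i)"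
  have finX: "finite X" using X by (rule finite_subset) simp
  have w: "0 < ?w j" if "j \<in> articles I" for j using I that by (intro short_len_pos) auto
  obtain x where opt: "knapsack_optimal X ?w (\<lambda>i. ?w i * ?h i) (real (budget I) / 2) x"
    and x: "\<forall>j\<in>X. (?h j > \<theta> \<longrightarrow> x j = 1) \<and> (?h j < \<theta> \<longrightarrow> x j = 0)"
    using thr unfolding is_threshold_def by blast
  have "hint I j < hint I i" if "i \<in> P" for i
    using P(2)[OF that j(1)] j(3) by (meson not_less)
  then have x1: "x i = 1" if "i \<in> X \<inter> P" for i
    using x j(2) that by (metis IntE le_less_trans of_nat_less_iff)
  have "(\<Sum>i\<in>X \<inter> P. ?w i) = (\<Sum>i\<in>X \<inter> P. ?w i * x i)" using x1 by simp
  also have "\<dots> \<le> (\<Sum>i\<in>X. ?w i * x i)"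
    using finX opt w X
    by (intro sum_mono2) (auto simp: knapsack_optimal_def knapsack_feasible_def less_imp_le subset_iff)
  also have "\<dots> \<le> real (budget I) / 2"
    using opt by (simp add: knapsack_optimal_def knapsack_feasible_def)
  finally show False using heavy by simp
qed

lemma round_time_le:
  assumes "0 \<le> g"
  shows "round_time g I \<theta> \<pi> r k \<le>
    (if r < k \<and> \<theta> \<le> real (hint I (inv \<pi> k)) then short_len g I (inv \<pi> k) else 0)"
  by (subst round_time.simps) (auto simp: short_len_def)

text \<open>If all unsampled articles at or above the threshold fit into the budget together, then
  in any arrival order enough time for \<open>i\<close> remains in its round.\<close>

lemma read_time_eq_short_len:
  assumes I: "rao_instance I" "0 < g" and \<pi>: "\<pi> permutes articles I"
    and fits: "(\<Sum>j\<in>{j \<in> articles I - sample I \<pi> r. \<rho> (sample I \<pi> r) \<le> real (hint I j)}. short_len g I j)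
      \<le> real (budget I)"
    and i: "i \<in> articles I - sample I \<pi> r" "\<rho> (sample I \<pi> r) \<le> real (hint I i)"
  shows "read_time g I \<rho> \<pi> r i = short_len g I i"
proof -
  define \<theta> where "\<theta> = \<rho> (sample I \<pi> r)"
  define R where "R = {j \<in> articles I - sample I \<pi> r. \<theta> \<le> real (hint I j)}"
  let ?w = "short_len g I"
  have finR: "finite R" by (simp add: R_def)
  have wR: "0 \<le> ?w j" if "j \<in> R" for j
    using short_len_pos[OF I(1) _ I(2), of j] that by (auto simp: R_def)
  have iR: "i \<in> R" using i by (simp add: R_def \<theta>_def)
  have \<pi>i: "\<pi> i \<in> articles I" using permutes_in_image[OF \<pi>] i(1) by simp
  define L where "L = {l \<in> {r<..<\<pi> i}. \<theta> \<le> real (hint I (inv \<pi> l))}"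
  have "(\<Sum>l\<in>{r<..<\<pi> i}. round_time g I \<theta> \<pi> r l) \<le>
      (\<Sum>l\<in>{r<..<\<pi> i}. if \<theta> \<le> real (hint I (inv \<pi> l)) then ?w (inv \<pi> l) else 0)"
    using I(2) by (intro sum_mono order_trans[OF round_time_le]) auto
  also have "\<dots> = (\<Sum>l\<in>L. ?w (inv \<pi> l))"
    unfolding L_def by (rule sum.inter_filter[symmetric]) simp
  also have "\<dots> = (\<Sum>j\<in>inv \<pi> ` L. ?w j)"
    by (subst sum.reindex) (auto intro: permutes_inj_on[OF permutes_inv[OF \<pi>]])
  also have "\<dots> \<le> (\<Sum>j\<in>R - {i}. ?w j)"
  proof (rule sum_mono2)
    \<comment> \<open>Rounds strictly between \<open>r\<close> and \<open>\<pi> i\<close> hold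
      unsampled articles other than \<open>i\<close>.\<close>
    show "inv \<pi> ` L \<subseteq> R - {i}"
    proof (intro image_subsetI)
      fix l assume l: "l \<in> L"
      then have "l \<in> articles I" using \<pi>i by (auto simp: L_def articles_def)
      then have "inv \<pi> l \<in> articles I" using permutes_in_image[OF permutes_inv[OF \<pi>]] by simp
      moreover have "\<pi> (inv \<pi> l) = l" using permutes_inverses(1)[OF \<pi>] .
      ultimately show "inv \<pi> l \<in> R - {i}"
        using l by (auto simp: L_def R_def sample_def)
    qed
  qed (use finR wR in auto)
  also have "\<dots> = (\<Sum>j\<in>R. ?w j) - ?w i" using finR iR by (simp add: sum_diff1)
  also have "\<dots> \<le> real (budget I) - ?w i" using fits by (simp add: R_def \<theta>_def)
  finally have "?w i \<le> real (budget I) - (\<Sum>l\<in>{r<..<\<pi> i}. round_time g I \<theta> \<pi> r l)" by simp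
  then have "Min {real (len I i), g * real (budget I),
      real (budget I) - (\<Sum>l\<in>{r<..<\<pi> i}. round_time g I \<theta> \<pi> r l)} = ?w i"
    by (simp add: short_len_def min_def split: if_splits)
  moreover have "r < \<pi> i" using i(1) by (auto simp: sample_def)
  ultimately show ?thesis
    unfolding read_time_def using permutes_inverses(2)[OF \<pi>, of i] i(2)
    by (subst round_time.simps) (simp add: \<theta>_def)
qed

text \<open>The deterministic core, for a single arrival order with a heavy sample: articles at or
  above the threshold lie in \<open>P\<close>, and those outside the sample weigh at most
  \<open>3/2 - 1/2 = 1\<close> times the budget. Hence every unsampled article of \<open>D\<close>
  is read for its truncated length.\<close>

lemma accuracy_mult_threshold_gain_ge:
  assumes I: "rao_instance I" "standing_assumptions g I" "0 < g" and rho: "threshold_rule g I \<rho>"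
    and \<pi>: "\<pi> permutes articles I"
    and P: "P \<subseteq> articles I" "\<And>i j. i \<in> P \<Longrightarrow> j \<in> articles I \<Longrightarrow> hint I i \<le> hint I j \<Longrightarrow> j \<in> P"
      "(\<Sum>i\<in>P. short_len g I i) \<le> 3/2 * real (budget I)"
    and D: "D \<subseteq> articles I" "\<And>i. i \<in> D \<Longrightarrow>
      (\<Sum>j\<in>{j\<in>articles I. hint I i < hint I j}. short_len g I j) < real (budget I) / 2"
    and heavy: "real (budget I) / 2 < (\<Sum>j\<in>sample I \<pi> r \<inter> P. short_len g I j)"
  shows "(\<Sum>i\<in>D - sample I \<pi> r. short_len g I i * real (hint I i)) \<le> accuracy I * threshold_gain g I \<rho> \<pi> r"
proof -
  define X where "X = sample I \<pi> r"
  let ?w = "short_len g I"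
  have X: "X \<subseteq> articles I" by (auto simp: X_def sample_def)
  have fin: "finite X" "finite P" using X P(1) by (auto intro: finite_subset)
  have thr: "is_threshold g I X (\<rho> X)" using rho X by (simp add: threshold_rule_def)
  have w: "0 < ?w j" if "j \<in> articles I" for j using I that by (intro short_len_pos) auto
  have acc: "1 \<le> accuracy I" using accuracy_is_least(1)[OF I(1)] by (simp add: accuracy_bound_def)
  have "(\<Sum>j\<in>X \<inter> P. ?w j) \<le> (\<Sum>j\<in>X. ?w j)"
    using fin w X by (intro sum_mono2) (auto intro: less_imp_le)
  then have full: "real (budget I) / 2 \<le> (\<Sum>j\<in>X. ?w j)" using heavy by (simp add: X_def)
  have sub: "{j\<in>articles I. \<rho> X \<le> real (hint I j)} \<subseteq> P"
    using heavy by (intro ge_threshold_subset[OF X thr I(1,3) P(1,2)]) (auto simp: X_def)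
  have "(\<Sum>j\<in>{j \<in> articles I - X. \<rho> X \<le> real (hint I j)}. ?w j) \<le> (\<Sum>j\<in>P - X \<inter> P. ?w j)"
    using sub fin w P(1) by (intro sum_mono2) (auto intro: less_imp_le)
  also have "\<dots> = (\<Sum>j\<in>P. ?w j) - (\<Sum>j\<in>X \<inter> P. ?w j)"
    using fin by (intro sum_diff) auto
  also have "\<dots> \<le> real (budget I)" using heavy P(3) by (simp add: X_def)
  finally have fits: "(\<Sum>j\<in>{j \<in> articles I - X. \<rho> X \<le> real (hint I j)}. ?w j) \<le> real (budget I)" .
  have "?w i * real (hint I i) \<le> accuracy I * info I i (read_time g I \<rho> \<pi> r i)" if i: "i \<in> D - X" for i
  proof -
    have iA: "i \<in> articles I" using D(1) i by auto
    have "\<rho> X \<le> real (hint I i)"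
      using i by (intro threshold_le_hint[OF I(1,3) X thr full] D(2)) auto
    then have "read_time g I \<rho> \<pi> r i = ?w i"
      using fits i iA by (intro read_time_eq_short_len[OF I(1,3) \<pi>]) (auto simp: X_def)
    moreover have "?w i * real (hint I i) \<le> accuracy I * info I i (?w i)"
      using I(2) iA w[OF iA]
      by (intro accuracy_mult_info_ge[OF I(1) iA])
        (auto simp: standing_assumptions_def short_len_def)
    ultimately show ?thesis by simp
  qed
  then have "(\<Sum>i\<in>D - X. ?w i * real (hint I i)) \<le>
      (\<Sum>i\<in>D - X. accuracy I * info I i (read_time g I \<rho> \<pi> r i))"
    by (rule sum_mono)
  also have "\<dots> \<le> (\<Sum>i\<in>articles I. accuracy I * info I i (read_time g I \<rho> \<pi> r i))"
    using D(1) acc by (intro sum_mono2) (auto simp: info_nonneg)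
  finally show ?thesis by (simp add: threshold_gain_def sum_distrib_left X_def)
qed

section \<open>The competitive ratio\<close>

lemma finite_obtain_max:
  fixes h :: "'a \<Rightarrow> 'b::linorder"
  assumes "finite S" "S \<noteq> {}"
  obtains k where "k \<in> S" "\<And>j. j \<in> S \<Longrightarrow> h j \<le> h k"
proof -
  have "Max (h ` S) \<in> h ` S" using assms by (intro Max_in) auto
  then obtain k where k: "k \<in> S" "h k = Max (h ` S)" by (metis imageE)
  have "h j \<le> h k" if "j \<in> S" for j
    unfolding k(2) using assms(1) that by (intro Max_ge) auto
  then show ?thesis using that k(1) by blast
qed

text \<open>A maximal upward closed set of weight at most \<open>c\<close> cannot take in the next
  element, whose weight is at most \<open>u\<close>.\<close>

lemma ex_heavy_prefix:
  fixes w :: "'a \<Rightarrow> real" and h :: "'a \<Rightarrow> 'b::linorder"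
  assumes A: "finite A" "inj_on h A" and w: "\<And>i. i \<in> A \<Longrightarrow> w i \<le> u"
    and c: "0 \<le> c" "c \<le> (\<Sum>i\<in>A. w i)" "0 \<le> u"
  obtains P where "P \<subseteq> A" "\<And>i j. i \<in> P \<Longrightarrow> j \<in> A \<Longrightarrow> h i \<le> h j \<Longrightarrow> j \<in> P"
    "(\<Sum>i\<in>P. w i) \<le> c" "c - u \<le> (\<Sum>i\<in>P. w i)"
proof -
  define F where "F = {P. P \<subseteq> A \<and> (\<forall>i\<in>P. \<forall>j\<in>A. h i \<le> h j \<longrightarrow> j \<in> P) \<and> (\<Sum>i\<in>P. w i) \<le> c}"
  have "finite F" by (rule finite_subset[of _ "Pow A"]) (use A(1) in \<open>auto simp: F_def\<close>)
  moreover have "{} \<in> F" using c by (simp add: F_def)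
  ultimately obtain P where P: "P \<in> F" and max: "\<And>Q. Q \<in> F \<Longrightarrow> P \<subseteq> Q \<Longrightarrow> Q = P"
    using finite_has_maximal2[of F "{}"] by blast
  have PA: "P \<subseteq> A" and up: "\<And>i j. i \<in> P \<Longrightarrow> j \<in> A \<Longrightarrow> h i \<le> h j \<Longrightarrow> j \<in> P"
    and le: "(\<Sum>i\<in>P. w i) \<le> c" using P by (auto simp: F_def)
  have "c - u \<le> (\<Sum>i\<in>P. w i)"
  proof (cases "P = A")
    case False
    then have ne: "A - P \<noteq> {}" using PA by auto
    obtain k where k: "k \<in> A - P" "\<And>j. j \<in> A - P \<Longrightarrow> h j \<le> h k"
      by (rule finite_obtain_max[OF finite_Diff ne, where h = h]) (use A in simp_all)
    have "insert k P \<notin> F" using max[of "insert k P"] k(1) by auto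
    \<comment> \<open>Injectivity of \<open>h\<close> excludes ties with \<open>k\<close>, so
      \<open>insert k P\<close> is upward closed and can only fail the weight bound.\<close>
    moreover have "j \<in> insert k P" if "i \<in> insert k P" "j \<in> A" "h i \<le> h j" for i j
    proof (cases "j \<in> P")
      case False
      then have "h j \<le> h k" using k(2) that(2) by simp
      moreover have "i = k" using that False up by auto
      ultimately have "h j = h k" using that(3) by simp
      then show ?thesis using inj_onD[OF A(2), of j k] that(2) k(1) by auto
    qed simp
    ultimately have "c < (\<Sum>i\<in>insert k P. w i)"
      using PA k(1) by (auto simp: F_def not_le)
    also have "\<dots> = w k + (\<Sum>i\<in>P. w i)"
      using k(1) finite_subset[OF PA A(1)] by simp
    finally show ?thesis using w[of k] k(1) by simp
  qed (use c in simp)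
  then show ?thesis using that PA up le by blast
qed

text \<open>An exchange argument. The set on the right includes the item at which the capacity is
  reached, so unless it is all of \<open>A\<close> it weighs at least \<open>c\<close>. The amounts
  \<open>y\<close> outside it then fit into its slack \<open>w - y\<close>, at values no
  smaller.\<close>

lemma sum_mult_le_top:
  fixes w y h :: "'a \<Rightarrow> real"
  assumes A: "finite A" and y: "\<And>i. i \<in> A \<Longrightarrow> 0 \<le> y i \<and> y i \<le> w i" "(\<Sum>i\<in>A. y i) \<le> c"
    and h: "\<And>i. i \<in> A \<Longrightarrow> 0 \<le> h i"
  shows "(\<Sum>i\<in>A. y i * h i) \<le> (\<Sum>i\<in>{i\<in>A. (\<Sum>j\<in>{j\<in>A. h i < h j}. w j) < c}. w i * h i)"
proof -
  define D where "D = {i\<in>A. (\<Sum>j\<in>{j\<in>A. h i < h j}. w j) < c}"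
  have D: "finite D" "D \<subseteq> A" using A by (auto simp: D_def)
  have "(\<Sum>i\<in>A. y i * h i) \<le> (\<Sum>i\<in>D. w i * h i)"
  proof (cases "D = A")
    case True
    then show ?thesis using y h by (auto intro!: sum_mono mult_right_mono)
  next
    case False
    then have ne: "A - D \<noteq> {}" using D(2) by auto
    obtain k where k: "k \<in> A - D" "\<And>j. j \<in> A - D \<Longrightarrow> h j \<le> h k"
      by (rule finite_obtain_max[OF finite_Diff ne, where h = h]) (use A in simp_all)
    have above: "{j\<in>A. h k < h j} \<subseteq> D"
    proof
      fix j assume "j \<in> {j\<in>A. h k < h j}"
      then show "j \<in> D" using k(2)[of j] by (cases "j \<in> D") auto
    qed
    have hD: "h k \<le> h i" if "i \<in> D" for i
    proof (rule ccontr)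
      assume "\<not> h k \<le> h i"
      then have "{j\<in>A. h k < h j} \<subseteq> {j\<in>A. h i < h j}" by auto
      then have "(\<Sum>j\<in>{j\<in>A. h k < h j}. w j) \<le> (\<Sum>j\<in>{j\<in>A. h i < h j}. w j)"
        using A y by (intro sum_mono2) (auto intro: order_trans)
      then show False using k(1) that by (auto simp: D_def)
    qed
    \<comment> \<open>The best item \<open>k\<close> outside \<open>D\<close> is outside only
      because the items above it, all in \<open>D\<close>, already weigh \<open>c\<close>.\<close>
    have "c \<le> (\<Sum>j\<in>{j\<in>A. h k < h j}. w j)" using k(1) by (auto simp: D_def)
    also have "\<dots> \<le> (\<Sum>i\<in>D. w i)"
      using D y above by (intro sum_mono2) (auto intro: order_trans)
    finally have "(\<Sum>i\<in>A. y i) \<le> (\<Sum>i\<in>D. w i)" using y(2) by simp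
    moreover have split: "(\<Sum>i\<in>A. f i) = (\<Sum>i\<in>A - D. f i) + (\<Sum>i\<in>D. f i)" for f :: "'a \<Rightarrow> real"
      using A D(2) by (rule sum.subset_diff[rotated])
    ultimately have rest: "(\<Sum>i\<in>A - D. y i) \<le> (\<Sum>i\<in>D. w i - y i)"
      using split[of y] by (simp add: sum_subtractf)
    have "(\<Sum>i\<in>A - D. y i * h i) \<le> (\<Sum>i\<in>A - D. y i * h k)"
      using k(2) y by (intro sum_mono mult_left_mono) auto
    also have "\<dots> \<le> (\<Sum>i\<in>D. w i - y i) * h k"
      unfolding sum_distrib_right[symmetric] using rest h k(1) by (intro mult_right_mono) auto
    also have "\<dots> \<le> (\<Sum>i\<in>D. (w i - y i) * h i)"
      unfolding sum_distrib_right using hD y D(2) by (intro sum_mono mult_left_mono) auto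
    finally show ?thesis
      unfolding split[of "\<lambda>i. y i * h i"] by (simp add: left_diff_distrib sum_subtractf)
  qed
  then show ?thesis by (simp add: D_def)
qed

section \<open>Bounds on the optimum and on the expected gain\<close>

lemma opt_le_top:
  assumes I: "rao_instance I" "standing_assumptions g I" and g: "0 < g" "g \<le> 1/2"
  shows "g * opt I \<le> (\<Sum>i\<in>{i\<in>articles I. (\<Sum>j\<in>{j\<in>articles I. hint I i < hint I j}. short_len g I j)
      < real (budget I) / 2}. short_len g I i * real (hint I i))"
    (is "_ \<le> ?V")
proof -
  have "opt I \<le> ?V / g"
    unfolding opt_def
  proof (rule cSUP_least[OF feasible_times_nonempty])
    fix \<tau> assume "\<tau> \<in> feasible_times I"
    then have \<tau>: "\<And>i. i \<in> articles I \<Longrightarrow> 0 \<le> \<tau> i \<and> \<tau> i \<le> real (len I i)"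
      "(\<Sum>i\<in>articles I. \<tau> i) \<le> real (budget I)"
      by (auto simp: feasible_times_def)
    \<comment> \<open>The bound by \<open>g\<close> times the budget uses that no article is longer
      than the budget; the bound by the length uses \<open>g \<le> 1\<close>.\<close>
    have "g * \<tau> i \<le> short_len g I i" if i: "i \<in> articles I" for i
    proof -
      have "\<tau> i \<le> real (budget I)"
        using \<tau>(1)[OF i] I(2) i by (force simp: standing_assumptions_def)
      moreover have "g * \<tau> i \<le> \<tau> i" using \<tau>(1)[OF i] g mult_right_mono[of g 1 "\<tau> i"] by simp
      ultimately show ?thesis using \<tau>(1)[OF i] g by (simp add: short_len_def)
    qed
    moreover have "(\<Sum>i\<in>articles I. g * \<tau> i) \<le> real (budget I) / 2"
      unfolding sum_distrib_left[symmetric] using mult_mono[OF g(2) \<tau>(2)] g \<tau>(1)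
      by (simp add: sum_nonneg)
    ultimately have "(\<Sum>i\<in>articles I. g * \<tau> i * real (hint I i)) \<le> ?V"
      using sum_mult_le_top[of "articles I" "\<lambda>i. g * \<tau> i" "short_len g I" "real (budget I) / 2"
          "\<lambda>i. real (hint I i)"] \<tau>(1) g
      by simp
    moreover have "(\<Sum>i\<in>articles I. info I i (\<tau> i)) \<le> (\<Sum>i\<in>articles I. \<tau> i * real (hint I i))"
      using \<tau>(1) by (intro sum_mono info_le_hint[OF I(1)]) auto
    ultimately show "(\<Sum>i\<in>articles I. info I i (\<tau> i)) \<le> ?V / g"
      using g(1) by (simp add: le_divide_eq mult.assoc sum_distrib_left[symmetric] mult.commute)
        (smt (verit) mult.commute mult_left_mono)
  qed
  then show ?thesis using g(1) by (simp add: le_divide_eq mult.commute)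
qed

text \<open>A lower bound on the gain that depends on the sample alone can be averaged over all sets
  of articles, whatever the order of the later arrivals.\<close>

lemma expected_threshold_gain_ge:
  assumes "\<And>\<pi> r. \<pi> permutes articles I \<Longrightarrow> F (sample I \<pi> r) \<le> threshold_gain g I \<rho> \<pi> r"
  shows "(\<Sum>X\<in>Pow (articles I). F X) / 2 ^ num_articles I \<le> expected_threshold_gain g I \<rho>"
proof -
  define M where "M = pair_pmf (pmf_of_set {\<pi>. \<pi> permutes articles I}) (binomial_pmf (num_articles I) (1/2))"
  have P: "finite {\<pi>. \<pi> permutes articles I}" "{\<pi>. \<pi> permutes articles I} \<noteq> {}"
    using permutes_id[of "articles I"] by (auto simp: finite_permutations simp del: permutes_id)
  then have setM: "set_pmf M = {\<pi>. \<pi> permutes articles I} \<times> {..num_articles I}"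
    by (simp add: M_def)
  then have fin: "finite (set_pmf M)" using P by simp
  have "(\<Sum>X\<in>Pow (articles I). F X) / 2 ^ num_articles I =
      measure_pmf.expectation (pmf_of_set (Pow (articles I))) F"
    by (subst integral_pmf_of_set) (auto simp: card_Pow articles_def)
  also have "\<dots> = measure_pmf.expectation M (\<lambda>(\<pi>, r). F (sample I \<pi> r))"
    unfolding map_pmf_sample[symmetric] M_def by (simp add: case_prod_unfold)
  also have "\<dots> \<le> measure_pmf.expectation M (\<lambda>(\<pi>, r). threshold_gain g I \<rho> \<pi> r)"
    using assms setM by (intro integral_mono_AE integrable_measure_pmf_finite fin)
      (auto simp: AE_measure_pmf_iff)
  finally show ?thesis by (simp add: expected_threshold_gain_def M_def)
qed

lemma accuracy_mult_expected_gain_ge: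
  assumes g: "g = 0.0215" and I: "rao_instance I" "standing_assumptions g I" and rho: "threshold_rule g I \<rho>"
    and D: "D \<subseteq> articles I" "\<And>i. i \<in> D \<Longrightarrow>
      (\<Sum>j\<in>{j\<in>articles I. hint I i < hint I j}. short_len g I j) < real (budget I) / 2"
  shows "0.35 * (\<Sum>i\<in>D. short_len g I i * real (hint I i)) \<le> accuracy I * expected_threshold_gain g I \<rho>"
proof -
  let ?A = "articles I" and ?T = "real (budget I)" and ?w = "short_len g I"
  have g0: "0 < g" using g by simp
  have T: "0 < ?T" using I(1) by (simp add: rao_instance_def)
  have w: "0 < ?w j" if "j \<in> ?A" for j using I g0 that by (intro short_len_pos) auto
  have wg: "?w j \<le> g * ?T" for j by (simp add: short_len_def)
  have acc: "1 \<le> accuracy I" using accuracy_is_least(1)[OF I(1)] by (simp add: accuracy_bound_def)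
  have "inj_on (hint I) ?A" "3/2 * ?T \<le> (\<Sum>i\<in>?A. ?w i)"
    using I(2) by (auto simp: standing_assumptions_def short_len_def min.commute)
  then obtain P where P: "P \<subseteq> ?A" "\<And>i j. i \<in> P \<Longrightarrow> j \<in> ?A \<Longrightarrow> hint I i \<le> hint I j \<Longrightarrow> j \<in> P"
    "(\<Sum>i\<in>P. ?w i) \<le> 3/2 * ?T" "3/2 * ?T - g * ?T \<le> (\<Sum>i\<in>P. ?w i)"
    using ex_heavy_prefix[of ?A "hint I" ?w "g * ?T" "3/2 * ?T"] wg g0 T by auto
  have w': "0 \<le> ?w j" if "j \<in> P" for j using w[of j] P(1) that by auto
  define E where "E X \<longleftrightarrow> ?T/2 < (\<Sum>j\<in>X \<inter> P. ?w j)" for X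
  define v where "v i = ?w i * real (hint I i)" for i
  \<comment> \<open>On samples that are not heavy, only nonnegativity of the gain is used.\<close>
  define F where "F X = (if E X then (\<Sum>i\<in>D - X. v i) else 0)" for X
  have v: "0 \<le> v i" if "i \<in> ?A" for i using w[OF that] by (simp add: v_def)
  have finD: "finite D" using D(1) by (rule finite_subset) simp
  have "F (sample I \<pi> r) / accuracy I \<le> threshold_gain g I \<rho> \<pi> r" if "\<pi> permutes ?A" for \<pi> r
    using accuracy_mult_threshold_gain_ge[OF I g0 rho that P(1-3) D, where r = r] acc
    by (auto simp: F_def E_def v_def threshold_gain_def divide_le_eq mult.commute info_nonneg sum_nonneg)
  then have "(\<Sum>X\<in>Pow ?A. F X / accuracy I) / 2 ^ num_articles I \<le> expected_threshold_gain g I \<rho>"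
    by (rule expected_threshold_gain_ge)
  then have exp: "(\<Sum>X\<in>Pow ?A. F X) / 2 ^ num_articles I \<le> accuracy I * expected_threshold_gain g I \<rho>"
    using acc by (simp add: sum_divide_distrib[symmetric] field_simps)
  have F: "F X = (\<Sum>i\<in>D. if i \<notin> X \<and> E X then v i else 0)" for X
    using finD by (auto simp: F_def sum.If_cases Diff_eq Collect_neg_eq)
  have "0.35 * (\<Sum>i\<in>D. v i) * 2 ^ num_articles I = (\<Sum>i\<in>D. v i * (0.35 * 2 ^ num_articles I))"
    by (subst sum_distrib_right[symmetric]) simp
  also have "\<dots> \<le> (\<Sum>i\<in>D. v i * real (card {X \<in> Pow ?A. i \<notin> X \<and> E X}))"
  proof (intro sum_mono mult_left_mono v)
    fix i assume "i \<in> D"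
    then have "0.35 * 2 ^ card ?A \<le> real (card {X \<in> Pow ?A. i \<notin> X \<and> ?T/2 < (\<Sum>j\<in>X \<inter> P. ?w j)})"
      using P D(1) T w' wg unfolding g
      by (intro card_subsets_notin_high_weight) auto
    then show "0.35 * 2 ^ num_articles I \<le> real (card {X \<in> Pow ?A. i \<notin> X \<and> E X})"
      by (simp add: E_def articles_def)
  qed (use D(1) in auto)
  \<comment> \<open>Double counting of the pairs of an article of \<open>D\<close> and a heavy
    sample that misses it.\<close>
  also have "\<dots> = (\<Sum>i\<in>D. \<Sum>X\<in>Pow ?A. if i \<notin> X \<and> E X then v i else 0)"
    by (simp add: sum.inter_filter[symmetric] mult.commute)
  also have "\<dots> = (\<Sum>X\<in>Pow ?A. F X)"
    unfolding F by (rule sum.swap)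
  finally have "0.35 * (\<Sum>i\<in>D. v i) \<le> (\<Sum>X\<in>Pow ?A. F X) / 2 ^ num_articles I"
    by (simp add: le_divide_eq)
  then have "0.35 * (\<Sum>i\<in>D. v i) \<le> accuracy I * expected_threshold_gain g I \<rho>"
    using exp by (rule order_trans)
  then show ?thesis by (simp only: v_def)
qed

text \<open>Eight terms of the exponential series give about 2.71825, just above
  \<open>246 / 90.5\<close>, which is about 2.71823; seven terms would be too few.\<close>

lemma exp_1_gt: "246 < 90.5 * exp (1::real)"
proof -
  have "(\<Sum>n<8. inverse (fact n) * 1 ^ n) \<le> (\<Sum>n. inverse (fact n) * (1::real) ^ n)"
    by (intro sum_le_suminf summable_exp) auto
  also have "\<dots> = exp 1" by (simp add: exp_def)
  finally show ?thesis by (simp add: eval_nat_numeral fact_numeral)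
qed

theorem theorem2:
  fixes g :: real and I :: rao and \<rho> :: "nat set \<Rightarrow> real"
  assumes "g = 0.0215"
    and "rao_instance I"
    and "standing_assumptions g I"
    and "threshold_rule g I \<rho>"
  shows "opt I \<le> 246 * accuracy I * expected_threshold_gain g I \<rho> \<and>
    246 * accuracy I < 90.5 * exp 1 * accuracy I"
proof
  define D where "D = {i\<in>articles I. (\<Sum>j\<in>{j\<in>articles I. hint I i < hint I j}. short_len g I j)
      < real (budget I) / 2}"
  define V where "V = (\<Sum>i\<in>D. short_len g I i * real (hint I i))"
  have acc: "1 \<le> accuracy I"
    using accuracy_is_least(1)[OF assms(2)] by (simp add: accuracy_bound_def)
  have "0.35 * V \<le> accuracy I * expected_threshold_gain g I \<rho>"
    unfolding V_def by (rule accuracy_mult_expected_gain_ge[OF assms]) (auto simp: D_def)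
  moreover have "g * opt I \<le> V"
    unfolding V_def D_def using assms(1) by (intro opt_le_top assms(2,3)) auto
  \<comment> \<open>This makes \<open>accuracy I * expected_threshold_gain g I \<rho>\<close>
    nonnegative, so the constant \<open>1 / (0.35 * g)\<close> may be enlarged to 246.\<close>
  moreover have "0 \<le> V"
    unfolding V_def using assms(1) by (intro sum_nonneg) (simp add: short_len_def)
  ultimately have "opt I \<le> 246 * (accuracy I * expected_threshold_gain g I \<rho>)"
    unfolding assms(1) by simp
  then show "opt I \<le> 246 * accuracy I * expected_threshold_gain g I \<rho>" by simp
  show "246 * accuracy I < 90.5 * exp 1 * accuracy I"
    using exp_1_gt acc by simp
qed

end
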